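(* Let ${\bf n}=n_0n_1n_2\cdots$ be the fixed point starting with $0$ of the morphism $0\mapsto01$, $1\mapsto2$, $2\mapsto0$. For $m\ge1$ let $A_m$ be the least integer $x$ such that every length-$m$ factor of ${\bf n}$ occurs in ${\bf n}$ at some starting position $j\le x$ (positions indexed from $0$). For $i\ge0$ let $D_i=\lfloor (N_i-N_{i+1}+2N_{i+2})/3\rfloor$. Then for every $m\ge2$ and every $i\ge0$ with $D_i<m\le D_{i+1}$, we have $A_m=N_{i+4}-1$.
   Context: The Narayana numbers are defined by $N_0=1$, $N_1=2$, $N_2=3$ and $N_i=N_{i-1}+N_{i-3}$ for $i\ge3$. *)

theory Defs
  imports Complex_Main "HOL-Library.Sublist"
begin

fun N :: "nat \<Rightarrow> nat" where
  "N 0 = 1"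
| "N (Suc 0) = 2"
| "N (Suc (Suc 0)) = 3"
| "N (Suc (Suc (Suc i))) = N (Suc (Suc i)) + N i"

definition D :: "nat \<Rightarrow> int" where
  "D i = \<lfloor>(real (N i) - real (N (i + 1)) + 2 * real (N (i + 2))) / 3\<rfloor>"

text \<open>
  Infinite words are functions on \<^typ>\<open>nat\<close>; \<open>factor w j m\<close> is the length-\<open>m\<close> factor
  of \<open>w\<close> starting at position \<open>j\<close>.
\<close>

definition factor :: "(nat \<Rightarrow> 'a) \<Rightarrow> nat \<Rightarrow> nat \<Rightarrow> 'a list" where
  "factor w j m = map w [j..<j + m]"

definition apply_morphism :: "('a \<Rightarrow> 'b list) \<Rightarrow> 'a list \<Rightarrow> 'b list" where
  "apply_morphism h u = concat (map h u)"

text \<open>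
  The image of an infinite word under a non-erasing morphism is the infinite word whose
  prefixes include the images of all finite prefixes. Hence \<open>h(w) = w\<close> says that the image of
  every prefix of \<open>w\<close> is again a prefix of \<open>w\<close>. (For erasing morphisms this would be too weak.)
\<close>

definition is_fixed_point :: "('a \<Rightarrow> 'a list) \<Rightarrow> (nat \<Rightarrow> 'a) \<Rightarrow> bool" where
  "is_fixed_point h w \<longleftrightarrow>
     (\<forall>k. let u = apply_morphism h (factor w 0 k) in u = factor w 0 (length u))"

datatype letter = L0 | L1 | L2

fun narayana_morphism :: "letter \<Rightarrow> letter list" where
  "narayana_morphism L0 = [L0, L1]"
| "narayana_morphism L1 = [L2]"
| "narayana_morphism L2 = [L0]"

definition appearance :: "(nat \<Rightarrow> 'a) \<Rightarrow> nat \<Rightarrow> nat" where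
  "appearance w m =
     (LEAST x. \<forall>u \<in> range (\<lambda>k. factor w k m). \<exists>j\<le>x. factor w j m = u)"

text \<open>
  Over a finite alphabet the set of bounds in \<open>appearance\<close> is nonempty, so \<open>LEAST\<close> denotes
  an actual minimum.
\<close>

lemma appearance_bound_exists:
  fixes w :: "nat \<Rightarrow> letter"
  shows "\<exists>x. \<forall>u \<in> range (\<lambda>k. factor w k m). \<exists>j\<le>x. factor w j m = u"
proof -
  let ?F = "range (\<lambda>k. factor w k m)"
  have "(UNIV :: letter set) = {L0, L1, L2}"
    using letter.exhaust by auto
  then have "finite (UNIV :: letter set)"
    by (metis finite.emptyI finite.insertI)
  then have "finite {xs :: letter list. set xs \<subseteq> UNIV \<and> length xs = m}"
    by (rule finite_lists_length_eq)
  moreover have "?F \<subseteq> {xs. set xs \<subseteq> UNIV \<and> length xs = m}"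
    by (auto simp: factor_def)
  ultimately have fin: "finite ?F"
    by (rule rev_finite_subset)
  define f where "f u = (SOME j. factor w j m = u)" for u
  have f: "factor w (f u) m = u" if "u \<in> ?F" for u
    using that unfolding f_def by (auto intro: someI)
  have "\<forall>u\<in>?F. f u \<le> Max (f ` ?F) \<and> factor w (f u) m = u"
    using fin f by auto
  then show ?thesis by blast
qed

lemma apply_morphism_append [simp]:
  "apply_morphism h (u @ v) = apply_morphism h u @ apply_morphism h v"
  by (simp add: apply_morphism_def)

lemma apply_morphism_mono: "prefix u v \<Longrightarrow> prefix (apply_morphism h u) (apply_morphism h v)"
  by (auto simp: prefix_def)

lemma factor_take: "k \<le> m \<Longrightarrow> take k (factor w 0 m) = factor w 0 k"
  by (simp add: factor_def take_map)

lemma length_factor [simp]: "length (factor w j m) = m"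
  by (simp add: factor_def)

abbreviation narayana_iterate :: "nat \<Rightarrow> letter list" where
  "narayana_iterate k \<equiv> (apply_morphism narayana_morphism ^^ k) [L0]"

lemma iterate_append:
  fixes h :: "'a \<Rightarrow> 'a list"
  shows "(apply_morphism h ^^ k) (u @ v) = (apply_morphism h ^^ k) u @ (apply_morphism h ^^ k) v"
proof (induction k)
  case (Suc k)
  then show ?case by simp
qed simp

lemma narayana_iterate_Suc:
  "narayana_iterate (Suc k) = narayana_iterate k @ (apply_morphism narayana_morphism ^^ k) [L1]"
proof -
  have "narayana_iterate (Suc k) = (apply_morphism narayana_morphism ^^ k) ([L0] @ [L1])"
    by (simp only: funpow_Suc_right comp_apply) (simp add: apply_morphism_def)
  then show ?thesis by (simp only: iterate_append)
qed

lemma narayana_image_nonempty: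
  "u \<noteq> [] \<Longrightarrow> apply_morphism narayana_morphism u \<noteq> []"
proof (cases u)
  case (Cons a v)
  then show ?thesis by (cases a) (auto simp: apply_morphism_def)
qed simp

lemma narayana_iterate_nonempty: "(apply_morphism narayana_morphism ^^ k) [a] \<noteq> []"
  by (induction k) (auto simp: narayana_image_nonempty)

lemma narayana_iterate_length: "k < length (narayana_iterate k)"
proof (induction k)
  case (Suc k)
  have "0 < length ((apply_morphism narayana_morphism ^^ k) [L1])"
    using narayana_iterate_nonempty by blast
  with Suc show ?case unfolding narayana_iterate_Suc length_append by linarith
qed simp

lemma narayana_iterate_prefix: "i \<le> k \<Longrightarrow> prefix (narayana_iterate i) (narayana_iterate k)"
proof (induction k rule: dec_induct)
  case (step k)
  show ?case unfolding narayana_iterate_Suc using step.IH by (rule prefix_prefix)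
qed simp

text \<open>The fixed point starting with \<open>0\<close> exists and is unique.\<close>

lemma narayana_fixed_point_ex1: "\<exists>!w. is_fixed_point narayana_morphism w \<and> w 0 = L0"
proof (rule ex_ex1I)
  define w where "w j = narayana_iterate j ! j" for j
  have w_nth: "narayana_iterate k ! j = w j" if "j < length (narayana_iterate k)" for j k
  proof (cases "j \<le> k")
    case True
    then show ?thesis
      using narayana_iterate_prefix[OF True] narayana_iterate_length[of j]
      by (auto simp: w_def prefix_def nth_append)
  next
    case False
    then have "k \<le> j" by simp
    from narayana_iterate_prefix[OF this] that show ?thesis
      by (auto simp: w_def prefix_def nth_append)
  qed
  have pre: "u = factor w 0 (length u)" if "prefix u (narayana_iterate k)" for u k
  proof (rule nth_equalityI)
    fix i assume i: "i < length u"
    with that have "i < length (narayana_iterate k)" "u ! i = narayana_iterate k ! i"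
      by (auto simp: prefix_def nth_append)
    then show "u ! i = factor w 0 (length u) ! i"
      using w_nth i by (simp add: factor_def)
  qed simp
  have "is_fixed_point narayana_morphism w"
    unfolding is_fixed_point_def Let_def
  proof
    fix k
    have "take k (narayana_iterate k) = take k (factor w 0 (length (narayana_iterate k)))"
      using pre[of "narayana_iterate k" k] by simp
    then have "factor w 0 k = take k (narayana_iterate k)"
      using narayana_iterate_length[of k] by (simp add: factor_take)
    then have "prefix (factor w 0 k) (narayana_iterate k)"
      by (simp add: take_is_prefix)
    then have "prefix (apply_morphism narayana_morphism (factor w 0 k)) (narayana_iterate (Suc k))"
      using apply_morphism_mono by simp
    then show "apply_morphism narayana_morphism (factor w 0 k) =
        factor w 0 (length (apply_morphism narayana_morphism (factor w 0 k)))"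
      by (rule pre)
  qed
  moreover have "w 0 = L0" by (simp add: w_def)
  ultimately show "\<exists>w. is_fixed_point narayana_morphism w \<and> w 0 = L0" by blast
next
  fix v w
  assume v: "is_fixed_point narayana_morphism v \<and> v 0 = L0"
    and w: "is_fixed_point narayana_morphism w \<and> w 0 = L0"
  have it: "narayana_iterate k = factor x 0 (length (narayana_iterate k))"
    if "is_fixed_point narayana_morphism x \<and> x 0 = L0" for x k
  proof (induction k)
    case 0
    then show ?case using that by (simp add: factor_def)
  next
    case (Suc k)
    then have "narayana_iterate (Suc k) =
        apply_morphism narayana_morphism (factor x 0 (length (narayana_iterate k)))"
      by simp
    then show ?case using that
      unfolding is_fixed_point_def Let_def by (simp del: funpow.simps)
  qed
  have nth: "x j = narayana_iterate j ! j"
    if "is_fixed_point narayana_morphism x \<and> x 0 = L0" for x j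
  proof -
    have "narayana_iterate j ! j = factor x 0 (length (narayana_iterate j)) ! j"
      using it[OF that, of j] by simp
    also have "\<dots> = x j"
      using narayana_iterate_length[of j] by (simp add: factor_def)
    finally show ?thesis by simp
  qed
  show "v = w"
    using nth[OF v] nth[OF w] by auto
qed

end

theory Submission
  imports Defs
begin

text \<open>
  Cut \<open>n\<close> into the level-\<open>k\<close> blocks \<open>\<phi>\<^sup>k(n\<^sub>0), \<phi>\<^sup>k(n\<^sub>1), \<dots>\<close>. What follows any block boundary of level
  \<open>i + 1\<close> agrees with \<open>n\<close> itself on exactly \<open>D\<^sub>i - 1\<close> letters if the next block is \<open>\<phi>\<^sup>i\<^sup>+\<^sup>1(1)\<close>, and on
  at least one letter more otherwise. Hence a factor of length at most \<open>D\<^sub>i\<^sub>+\<^sub>1\<close> is determined by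
  the letter indexing the level-\<open>(i + 2)\<close> block in which it starts and by its offset there, so it
  already starts inside \<open>\<phi>\<^sup>i\<^sup>+\<^sup>2(012)\<close>, which has length \<open>N\<^sub>i\<^sub>+\<^sub>4\<close>.

  Conversely, the last letter of \<open>\<phi>\<^sup>i\<^sup>+\<^sup>1(0)\<close> followed by the prefix of \<open>n\<close> of length \<open>D\<^sub>i\<close> occurs only
  across the boundary between two consecutive blocks \<open>\<phi>\<^sup>i\<^sup>+\<^sup>1(0)\<close>. Since \<open>n\<close> starts with \<open>01200\<close>, the
  first such boundary is at \<open>|\<phi>\<^sup>i\<^sup>+\<^sup>1(0120)| = N\<^sub>i\<^sub>+\<^sub>4\<close>.
\<close>

section \<open>Factors and prefixes of infinite words\<close>

lemma factor_add: "factor w i (r + s) = factor w i r @ factor w (i + r) s"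
  using upt_add_eq_append[of i "i + r" s] by (simp add: factor_def add.assoc)

lemma factor_1: "factor w i (Suc 0) = [w i]"
  by (simp add: factor_def)

lemma nth_factor: "u < m \<Longrightarrow> factor w i m ! u = w (i + u)"
  by (simp add: factor_def)

lemma factor_eq_iff: "factor v i m = factor w j m \<longleftrightarrow> (\<forall>u < m. v (i + u) = w (j + u))"
  by (simp add: list_eq_iff_nth_eq nth_factor)

lemma appearance_eqI:
  assumes "\<And>k. \<exists>j \<le> x. factor w j m = factor w k m"
    and "\<And>j. factor w j m = factor w x m \<Longrightarrow> x \<le> j"
  shows "appearance w m = x"
  unfolding appearance_def
proof (rule Least_equality)
  show "\<forall>u \<in> range (\<lambda>k. factor w k m). \<exists>j \<le> x. factor w j m = u"
    using assms(1) by blast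
next
  fix y assume "\<forall>u \<in> range (\<lambda>k. factor w k m). \<exists>j \<le> y. factor w j m = u"
  then obtain j where "j \<le> y" "factor w j m = factor w x m" by blast
  then show "x \<le> y" using assms(2) le_trans by blast
qed

definition prefix_occurs :: "(nat \<Rightarrow> 'a) \<Rightarrow> nat \<Rightarrow> nat \<Rightarrow> bool" where
  "prefix_occurs w r s \<longleftrightarrow> factor w r s = factor w 0 s"

lemma prefix_occurs_iff: "prefix_occurs w r s \<longleftrightarrow> (\<forall>u < s. w (r + u) = w u)"
  by (simp add: prefix_occurs_def factor_eq_iff)

lemma prefix_occurs_Suc: "prefix_occurs w r (Suc s) \<longleftrightarrow> prefix_occurs w r s \<and> w (r + s) = w s"
  by (auto simp: prefix_occurs_iff less_Suc_eq)

lemma prefix_occurs_mono: "prefix_occurs w r s \<Longrightarrow> s' \<le> s \<Longrightarrow> prefix_occurs w r s'"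
  by (simp add: prefix_occurs_iff)

section \<open>Fixed points of non-erasing morphisms\<close>

locale nonerasing_fixed_point =
  fixes h :: "'a \<Rightarrow> 'a list" and w :: "nat \<Rightarrow> 'a"
  assumes fixed_point: "is_fixed_point h w" and nonerasing: "h a \<noteq> []"
begin

definition image_start :: "nat \<Rightarrow> nat" where
  "image_start t = length (apply_morphism h (factor w 0 t))"

abbreviation block_start :: "nat \<Rightarrow> nat \<Rightarrow> nat" where
  "block_start k \<equiv> image_start ^^ k"

abbreviation block :: "nat \<Rightarrow> 'a \<Rightarrow> 'a list" where
  "block k a \<equiv> (apply_morphism h ^^ k) [a]"

abbreviation block_last :: "nat \<Rightarrow> 'a \<Rightarrow> 'a" where
  "block_last k \<equiv> (\<lambda>a. last (h a)) ^^ k"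

lemma image_start_0 [simp]: "image_start 0 = 0"
  by (simp add: image_start_def factor_def apply_morphism_def)

lemma block_start_0 [simp]: "block_start k 0 = 0"
  by (induction k) simp_all

lemma iterate_prefix: "(apply_morphism h ^^ k) (factor w 0 t) = factor w 0 (block_start k t)"
proof (induction k)
  case (Suc k)
  then show ?case
    using fixed_point by (simp add: is_fixed_point_def Let_def image_start_def)
qed simp

lemma prefix_block_start_add:
  "factor w 0 (block_start k (r + s)) =
   factor w 0 (block_start k r) @ (apply_morphism h ^^ k) (factor w r s)"
  unfolding iterate_prefix[symmetric] factor_add by (simp add: iterate_append)

lemma block_start_add:
  "block_start k (r + s) = block_start k r + length ((apply_morphism h ^^ k) (factor w r s))"
  using arg_cong[OF prefix_block_start_add, of length] by simp

lemma factor_block_start: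
  "factor w (block_start k r) (length ((apply_morphism h ^^ k) (factor w r s))) =
   (apply_morphism h ^^ k) (factor w r s)"
  using prefix_block_start_add[of k r s] unfolding block_start_add factor_add by simp

lemma block_start_Suc: "block_start k (Suc t) = block_start k t + length (block k (w t))"
  using block_start_add[of k t "Suc 0"] by (simp add: factor_1)

lemma nth_block:
  assumes "u < length (block k (w t))"
  shows "w (block_start k t + u) = block k (w t) ! u"
  using factor_block_start[of k t "Suc 0"] nth_factor[OF assms] by (metis factor_1)

lemma image_start_Suc: "image_start (Suc t) = image_start t + length (h (w t))"
  using block_start_Suc[of "Suc 0" t] by (simp add: apply_morphism_def)

lemma nth_image: "u < length (h (w t)) \<Longrightarrow> w (image_start t + u) = h (w t) ! u"
  using nth_block[of u "Suc 0" t] by (simp add: apply_morphism_def)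

lemma strict_mono_image_start: "strict_mono image_start"
  using nonerasing by (simp add: strict_mono_Suc_iff image_start_Suc)

lemma strict_mono_block_start: "strict_mono (block_start k)"
  by (induction k) (simp_all add: strict_mono_def strict_mono_less[OF strict_mono_image_start])

lemma image_start_eq_iff [simp]: "image_start s = image_start t \<longleftrightarrow> s = t"
  using strict_mono_image_start by (rule strict_mono_eq)

lemma block_position:
  obtains t u where "j = block_start k t + u" "u < length (block k (w t))"
proof -
  have "j < block_start k (Suc j)"
    using strict_mono_imp_increasing[OF strict_mono_block_start, of "Suc j" k] by simp
  then obtain t where "block_start k t \<le> j" "j < block_start k (Suc t)"
    using ex_least_nat_less[of "\<lambda>t. j < block_start k t"] by (auto simp: not_less)
  then show ?thesis
    by (intro that[of t "j - block_start k t"]) (auto simp: block_start_Suc)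
qed

lemma image_position:
  obtains t u where "j = image_start t + u" "u < length (h (w t))" "w j = h (w t) ! u"
  using block_position[of j "Suc 0"] nth_image by (auto simp: apply_morphism_def)

lemma last_of_image:
  assumes "image_start (Suc t) = Suc q"
  shows "w q = last (h (w t))"
proof -
  have "q = image_start t + (length (h (w t)) - 1)"
    using assms nonerasing[of "w t"] by (cases "h (w t)") (simp_all add: image_start_Suc)
  then show ?thesis
    using nth_image[of "length (h (w t)) - 1" t] nonerasing[of "w t"] by (simp add: last_conv_nth)
qed

lemma last_of_block:
  assumes "block_start k (Suc t) = Suc q"
  shows "w q = block_last k (w t)"
  using assms
proof (induction k arbitrary: q)
  case (Suc k)
  have "0 < block_start k (Suc t)"
    using strict_monoD[OF strict_mono_block_start, of 0 "Suc t" k] by simp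
  then obtain p where p: "block_start k (Suc t) = Suc p" using gr0_implies_Suc by blast
  then show ?case using Suc.IH Suc.prems last_of_image[of p q] by simp
qed simp

lemma block_start_add_prefix:
  "prefix_occurs w r s \<Longrightarrow> block_start k (r + s) = block_start k r + block_start k s"
  using block_start_add[of k 0 s] by (simp add: block_start_add prefix_occurs_def)

lemma image_start_add_prefix:
  "prefix_occurs w r s \<Longrightarrow> image_start (r + s) = image_start r + image_start s"
  using block_start_add_prefix[of r s "Suc 0"] by simp

lemma prefix_occurs_block_start_image:
  assumes "prefix_occurs w r s"
  shows "prefix_occurs w (block_start k r) (block_start k s)"
  using factor_block_start[of k r s] assms by (simp add: prefix_occurs_def iterate_prefix)

end

section \<open>The Narayana word\<close>

lemma N_pos: "0 < N k"
  by (induction k rule: N.induct) simp_all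

lemma D_eq_div: "D i = (int (N i) - int (N (i + 1)) + 2 * int (N (i + 2))) div 3"
  using floor_divide_of_int_eq[of "int (N i) - int (N (i + 1)) + 2 * int (N (i + 2))" 3,
      where ?'a = real]
  by (simp add: D_def)

lemma D_add_4: "D (i + 4) = D i + int (N (i + 4))"
proof -
  have "int (N (i + 4)) - int (N (i + 4 + 1)) + 2 * int (N (i + 4 + 2)) =
      int (N i) - int (N (i + 1)) + 2 * int (N (i + 2)) + int (N (i + 4)) * 3"
    by (simp add: numeral_eq_Suc)
  then show ?thesis unfolding D_eq_div by simp
qed

lemma length_narayana_iterate: "length (narayana_iterate k) = N k"
proof -
  have iterate_L1: "(apply_morphism narayana_morphism ^^ Suc k) [L1] =
      (apply_morphism narayana_morphism ^^ k) [L2]"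
    and iterate_L2: "(apply_morphism narayana_morphism ^^ Suc k) [L2] = narayana_iterate k" for k
    by (simp_all only: funpow_Suc_right comp_apply) (simp_all add: apply_morphism_def)
  show ?thesis
    by (induction k rule: N.induct)
      (simp_all only: narayana_iterate_Suc iterate_L1 iterate_L2 length_append,
        simp_all add: numeral_eq_Suc)
qed

lemma inj_last_narayana_morphism: "inj (\<lambda>a. last (narayana_morphism a))"
proof (rule injI)
  fix a b assume "last (narayana_morphism a) = last (narayana_morphism b)"
  then show "a = b" by (cases a; cases b) simp_all
qed

locale narayana_word = nonerasing_fixed_point narayana_morphism w for w +
  assumes start: "w 0 = L0"
begin

lemma block_start_1: "block_start k 1 = N k"
  using block_start_Suc[of k 0] start by (simp add: length_narayana_iterate)

lemma block_start_N: "block_start j (N k) = N (j + k)"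
  unfolding block_start_1[symmetric] by (simp add: funpow_add)

lemma block_start_3: "block_start k 3 = N (k + 2)"
  and block_start_4: "block_start k 4 = N (k + 3)"
  using block_start_N[of k 2] block_start_N[of k 3] by (simp_all add: numeral_eq_Suc)

lemma image_start_values:
  "image_start (Suc 0) = 2" "image_start 2 = 3" "image_start 3 = 4" "image_start 4 = 6"
  using block_start_N[of "Suc 0" 0] block_start_N[of "Suc 0" 1] block_start_N[of "Suc 0" 2]
    block_start_N[of "Suc 0" 3]
  by (simp_all add: numeral_eq_Suc)

lemma first_letters: "w 1 = L1" "w 2 = L2" "w 3 = L0" "w 4 = L0"
  using nth_block[of _ 4 0] start
  by (simp_all add: numeral_eq_Suc apply_morphism_def del: One_nat_def)

lemma obtain_first_occurrence:
  obtains t where "t < 3" "w t = a"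
  using that[of 0] that[of 1] that[of 2] start first_letters by (cases a) auto

lemma nth_image_start: "w (image_start t) = (if w t = L1 then L2 else L0)"
  using nth_image[of 0 t] by (cases "w t") auto

lemma L1_position:
  assumes "w j = L1"
  obtains t where "j = Suc (image_start t)" "w t = L0"
  using image_position[of j]
proof cases
  case (1 t u)
  then show ?thesis using that assms by (cases "w t") (auto simp: less_Suc_eq)
qed

lemma image_start_position:
  assumes "w j \<noteq> L1"
  obtains t where "j = image_start t"
  using image_position[of j]
proof cases
  case (1 t u)
  then show ?thesis using that assms by (cases "w t") (auto simp: less_Suc_eq)
qed

lemma nth_Suc_image_start_eq_L1_iff: "w (Suc (image_start t)) = L1 \<longleftrightarrow> w t = L0"
proof
  assume "w (Suc (image_start t)) = L1"
  then show "w t = L0" using L1_position by force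
next
  assume "w t = L0"
  then show "w (Suc (image_start t)) = L1" using nth_image[of 1 t] by simp
qed

lemma before_L1: "w (Suc j) = L1 \<Longrightarrow> w j = L0"
  by (erule L1_position) (simp add: nth_image_start)

lemma before_L2:
  assumes "w (Suc j) = L2"
  shows "w j = L1"
proof -
  obtain t where t: "Suc j = image_start t" using image_start_position[of "Suc j"] assms by auto
  then obtain r where r: "t = Suc r" by (cases t) auto
  have "w (Suc r) = L1" using assms nth_image_start[of t] by (simp add: t r split: if_splits)
  then have "w r = L0" by (rule before_L1)
  then show ?thesis using last_of_image[of r j] t r by simp
qed

lemma after_L2: "w j = L2 \<Longrightarrow> w (Suc j) = L0"
  using before_L1[of j] before_L2[of j] by (cases "w (Suc j)") auto

lemma nth_Suc_image_start_L2: "w t = L2 \<Longrightarrow> w (Suc (image_start t)) = L0"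
  using nth_image_start[of "Suc t"] after_L2[of t] by (simp add: image_start_Suc)

lemma letter_determined_by_image:
  assumes "w (image_start s) = w (image_start t)"
    and "w (Suc (image_start s)) = w (Suc (image_start t))"
  shows "w s = w t"
proof -
  have "w s = L1 \<longleftrightarrow> w t = L1" using assms(1) by (simp add: nth_image_start split: if_splits)
  moreover have "w s = L0 \<longleftrightarrow> w t = L0"
    using assms(2) nth_Suc_image_start_eq_L1_iff by metis
  ultimately show ?thesis by (cases "w s"; cases "w t") simp_all
qed

section \<open>Agreement of block boundaries with the start of the word\<close>

text \<open>The two letters that can follow the common prefix alternate between \<open>{0, 2}\<close>, whose images
  share their first letter, and \<open>{0, 1}\<close>, whose images do not; hence the parity term.\<close>

fun agreement :: "nat \<Rightarrow> nat" where
  "agreement 0 = 0"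
| "agreement (Suc i) = image_start (agreement i) + of_bool (even i)"

definition branch_letters :: "nat \<Rightarrow> letter set" where
  "branch_letters i = (if even i then {L0, L2} else {L0, L1})"

text \<open>A \<open>2\<close> is always followed by a \<open>0\<close>, which supplies the second letter when \<open>\<phi>(2)\<close> has none.\<close>

definition next_branch_letter :: "nat \<Rightarrow> letter \<Rightarrow> letter" where
  "next_branch_letter i a = (narayana_morphism a @ [L0]) ! of_bool (even i)"

lemma next_branch_letter_mem:
  "a \<in> branch_letters i \<Longrightarrow> next_branch_letter i a \<in> branch_letters (Suc i)"
  by (auto simp: branch_letters_def next_branch_letter_def split: if_splits)

lemma inj_on_next_branch_letter: "inj_on (next_branch_letter i) (branch_letters i)"
  by (auto simp: inj_on_def branch_letters_def next_branch_letter_def)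

lemma nth_next_branch_letter:
  assumes "w t \<in> branch_letters i"
  shows "w (image_start t + of_bool (even i)) = next_branch_letter i (w t)"
  using assms nth_image_start[of t] nth_Suc_image_start_eq_L1_iff[of t] nth_Suc_image_start_L2[of t]
  by (auto simp: branch_letters_def next_branch_letter_def split: if_splits)

definition branches :: "nat \<Rightarrow> nat \<Rightarrow> bool" where
  "branches i r \<longleftrightarrow> prefix_occurs w r (agreement i) \<and> w (r + agreement i) \<in> branch_letters i"

lemma image_branch_letter:
  assumes "branches i r"
  shows "w (image_start r + agreement (Suc i)) = next_branch_letter i (w (r + agreement i))"
  using assms nth_next_branch_letter[of "r + agreement i" i]
  by (simp add: branches_def image_start_add_prefix add.assoc)

lemma branches_image:
  assumes "branches i 0" and "branches i r"
  shows "branches (Suc i) (image_start r)"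
proof -
  let ?e = "agreement i"
  have agree: "prefix_occurs w r ?e"
    and letters: "w ?e \<in> branch_letters i" "w (r + ?e) \<in> branch_letters i"
    using assms by (simp_all add: branches_def)
  have "w (image_start r + image_start ?e) = w (image_start ?e)" if "even i"
    using letters that nth_image_start[of ?e] nth_image_start[of "r + ?e"]
    by (auto simp: image_start_add_prefix[OF agree] branch_letters_def)
  then have "prefix_occurs w (image_start r) (agreement (Suc i))"
    using prefix_occurs_block_start_image[OF agree, of "Suc 0"] by (simp add: prefix_occurs_Suc)
  moreover have "w (image_start r + agreement (Suc i)) \<in> branch_letters (Suc i)"
    unfolding image_branch_letter[OF assms(2)] by (rule next_branch_letter_mem) (rule letters)
  ultimately show ?thesis by (simp add: branches_def)
qed

lemma branches_block_start: "branches i (block_start (Suc i) t)"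
proof (induction i arbitrary: t)
  case 0
  show ?case using nth_image_start[of t]
    by (simp add: branches_def prefix_occurs_iff branch_letters_def)
next
  case (Suc i)
  show ?case using branches_image[OF Suc.IH[of 0, simplified] Suc.IH[of t]] by simp
qed

lemma branches_0: "branches i 0"
  using branches_block_start[of i 0] by simp

lemma prefix_occurs_block_start: "prefix_occurs w (block_start (Suc i) t) (agreement i)"
  using branches_block_start[of i t] by (simp add: branches_def)

lemma nth_agreement_eq_iff:
  "w (block_start (Suc i) t + agreement i) = w (agreement i) \<longleftrightarrow> w t \<noteq> L1"
proof (induction i)
  case 0
  show ?case using nth_image_start[of t] start by simp
next
  case (Suc i)
  let ?r = "block_start (Suc i) t"
  have "w (block_start (Suc (Suc i)) t + agreement (Suc i)) =
      next_branch_letter i (w (?r + agreement i))"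
    using image_branch_letter[OF branches_block_start[of i t]] by simp
  moreover have "w (agreement (Suc i)) = next_branch_letter i (w (agreement i))"
    using image_branch_letter[OF branches_0[of i]] by simp
  moreover have "w (?r + agreement i) \<in> branch_letters i" "w (agreement i) \<in> branch_letters i"
    using branches_block_start[of i t] branches_0[of i] by (simp_all add: branches_def)
  ultimately show ?case
    using Suc.IH inj_on_eq_iff[OF inj_on_next_branch_letter] by metis
qed

lemma agreement_Suc_pos: "0 < agreement (Suc i)"
proof (induction i)
  case (Suc i)
  then show ?case
    using strict_monoD[OF strict_mono_image_start, of 0 "agreement (Suc i)"] by simp
qed simp

lemma before_odd_agreement:
  assumes "odd i"
  obtains s where "agreement i = Suc s" "w s = L0"
proof -
  obtain j where j: "i = Suc j" "even j" using assms by (cases i) auto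
  have "w (image_start (agreement j)) = L0"
    using branches_0[of j] j by (auto simp: branches_def branch_letters_def nth_image_start)
  then show ?thesis using j that by simp
qed

lemma agreement_values: "agreement 1 = 1" "agreement 2 = 2" "agreement 3 = 4" "agreement 4 = 6"
  using agreement.simps(2)[of 1] agreement.simps(2)[of 2] agreement.simps(2)[of 3]
    image_start_values
  by (simp_all flip: numeral_2_eq_2)

lemma agreement_add_4: "agreement (i + 4) = N (i + 4) + agreement i"
proof (induction i)
  case 0
  show ?case using agreement_values by (simp add: numeral_eq_Suc)
next
  case (Suc i)
  have "prefix_occurs w (N (i + 4)) (agreement i)"
    using prefix_occurs_block_start[of i 4] unfolding block_start_4 by (simp add: add.commute)
  then have "image_start (N (i + 4) + agreement i) = N (Suc i + 4) + image_start (agreement i)"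
    using block_start_N[of "Suc 0" "i + 4"] by (simp add: image_start_add_prefix)
  then show ?case using Suc.IH agreement.simps(2)[of "i + 4"] by simp
qed

lemma D_eq_agreement: "D i = int (agreement i) + 1"
proof (induction i rule: less_induct)
  case (less i)
  show ?case
  proof (cases "i < 4")
    case True
    then consider "i = 0" | "i = 1" | "i = 2" | "i = 3" by linarith
    then show ?thesis
      using agreement_values by cases (simp_all add: D_eq_div numeral_eq_Suc)
  next
    case False
    then obtain j where "i = j + 4" by (metis le_add_diff_inverse2 not_less)
    then show ?thesis using less[of j] D_add_4[of j] agreement_add_4[of j] by simp
  qed
qed

section \<open>Early occurrences\<close>

lemma nth_block_extension:
  assumes "w t' = w t" and "u < length (block (Suc i) (w t)) + agreement i"
  shows "w (block_start (Suc i) t' + u) = w (block_start (Suc i) t + u)"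
proof (cases "u < length (block (Suc i) (w t))")
  case True
  then show ?thesis using nth_block assms(1) by metis
next
  case False
  then obtain s where s: "u = length (block (Suc i) (w t)) + s" "s < agreement i"
    using assms(2) by (metis add_less_cancel_left le_add_diff_inverse not_less)
  have "w (block_start (Suc i) x + u) = w s" if "w x = w t" for x
  proof -
    have "block_start (Suc i) x + u = block_start (Suc i) (Suc x) + s"
      unfolding block_start_Suc that s(1) by simp
    moreover have "w (block_start (Suc i) (Suc x) + s) = w s"
      using prefix_occurs_block_start[of i "Suc x"] s(2) unfolding prefix_occurs_iff by blast
    ultimately show ?thesis by (simp only:)
  qed
  then show ?thesis using assms(1) by simp
qed

lemma factor_occurs_below_N:
  assumes "m \<le> agreement (Suc i) + 1"
  obtains j' where "j' < N (i + 4)" "factor w j' m = factor w j m"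
proof -
  let ?k = "Suc (Suc i)"
  obtain t p where j: "j = block_start ?k t + p" and p: "p < length (block ?k (w t))"
    using block_position by blast
  obtain t' where t': "t' < 3" "w t' = w t" by (rule obtain_first_occurrence)
  have "block_start ?k t' + p < block_start ?k (Suc t')"
    using p t'(2) by (simp only: block_start_Suc)
  also have "\<dots> \<le> block_start ?k 3"
    using t'(1) by (simp only: strict_mono_less_eq[OF strict_mono_block_start])
  also have "\<dots> = N (i + 4)" by (simp only: block_start_3) (simp add: numeral_eq_Suc)
  finally have "block_start ?k t' + p < N (i + 4)" .
  moreover have "w (block_start ?k t' + (p + u)) = w (block_start ?k t + (p + u))" if "u < m" for u
    using t'(2) by (rule nth_block_extension) (use p that assms in linarith)
  then have "factor w (block_start ?k t' + p) m = factor w j m"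
    by (simp add: factor_eq_iff j add.assoc)
  ultimately show ?thesis using that by blast
qed

section \<open>Recognizability and late occurrences\<close>

text \<open>The extra letter is needed to tell \<open>\<phi>(0) = 01\<close> from \<open>\<phi>(2) = 0\<close> at the end of the prefix.\<close>

lemma prefix_occurs_preimage:
  "prefix_occurs w (image_start r) (Suc (image_start s)) \<Longrightarrow> prefix_occurs w r s"
proof (induction s)
  case 0
  show ?case by (simp add: prefix_occurs_iff)
next
  case (Suc s)
  have "Suc (image_start s) < Suc (image_start (Suc s))"
    using strict_monoD[OF strict_mono_image_start, of s "Suc s"] by simp
  then have agree_image: "prefix_occurs w (image_start r) (Suc (Suc (image_start s)))"
    using prefix_occurs_mono[OF Suc.prems] by simp
  then have agree: "prefix_occurs w r s" using Suc.IH by (simp add: prefix_occurs_Suc)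
  have "w (r + s) = w s"
    using agree_image image_start_add_prefix[OF agree]
    by (auto simp: prefix_occurs_Suc intro!: letter_determined_by_image[of "r + s" s])
  then show ?case using agree by (simp add: prefix_occurs_Suc)
qed

lemma prefix_occurs_agreement_preimage:
  assumes "prefix_occurs w (image_start r) (agreement (Suc i))"
  shows "prefix_occurs w r (agreement i)"
proof (cases "even i")
  case True
  with assms have "prefix_occurs w (image_start r) (Suc (image_start (agreement i)))" by simp
  then show ?thesis by (rule prefix_occurs_preimage)
next
  case False
  then obtain s where s: "agreement i = Suc s" "w s = L0" using before_odd_agreement by blast
  then have agree_image: "prefix_occurs w (image_start r) (Suc (Suc (image_start s)))"
    using assms False by (simp add: image_start_Suc)
  then have "prefix_occurs w (image_start r) (Suc (image_start s))"
    by (simp add: prefix_occurs_Suc)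
  then have agree: "prefix_occurs w r s" by (rule prefix_occurs_preimage)
  have "w (Suc (image_start (r + s))) = L1"
    using agree_image s(2) by (simp add: prefix_occurs_Suc image_start_add_prefix[OF agree]
        nth_Suc_image_start_eq_L1_iff)
  then show ?thesis
    using agree s by (simp add: prefix_occurs_Suc nth_Suc_image_start_eq_L1_iff)
qed

lemma recognizability:
  assumes "w q = block_last (Suc i) L0"
    and "prefix_occurs w (Suc q) (agreement i)"
  shows "\<exists>t. Suc q = block_start (Suc i) (Suc t) \<and> w t = L0"
  using assms
proof (induction i arbitrary: q)
  case 0
  then have "w q = L1" by simp
  then obtain t where "q = Suc (image_start t)" "w t = L0" by (rule L1_position)
  then have "Suc q = block_start (Suc 0) (Suc t)" by (simp add: image_start_Suc)
  then show ?case using \<open>w t = L0\<close> by blast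
next
  case (Suc i)
  have "w (Suc q) = w 0"
    using Suc.prems(2) agreement_Suc_pos[of i] unfolding prefix_occurs_iff by force
  then obtain r where r: "Suc q = image_start r"
    using image_start_position[of "Suc q"] start by auto
  then obtain p where "r = Suc p" by (cases r) auto
  with r have p: "Suc q = image_start (Suc p)" by simp
  have "last (narayana_morphism (w p)) = last (narayana_morphism (block_last (Suc i) L0))"
    using last_of_image[OF p[symmetric]] Suc.prems(1) by simp
  then have "w p = block_last (Suc i) L0" by (rule injD[OF inj_last_narayana_morphism])
  moreover have "prefix_occurs w (Suc p) (agreement i)"
    using Suc.prems(2) unfolding p by (rule prefix_occurs_agreement_preimage)
  ultimately obtain t where "Suc p = block_start (Suc i) (Suc t)" "w t = L0"
    using Suc.IH by blast
  then show ?case using p by auto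
qed

lemma N_le_recognized_boundary:
  assumes "w q = block_last (Suc i) L0"
    and "prefix_occurs w (Suc q) (Suc (agreement i))"
  shows "N (i + 4) \<le> Suc q"
proof -
  obtain t where t: "Suc q = block_start (Suc i) (Suc t)" "w t = L0"
    using recognizability assms unfolding prefix_occurs_Suc by blast
  have "w (Suc t) \<noteq> L1"
    using assms(2) nth_agreement_eq_iff unfolding t(1) prefix_occurs_Suc by blast
  then have "t \<noteq> 0" using first_letters(1) by (intro notI) simp
  moreover have "t \<noteq> 1" "t \<noteq> 2" using t(2) first_letters by auto
  ultimately have "4 \<le> Suc t" by linarith
  then have "block_start (Suc i) 4 \<le> block_start (Suc i) (Suc t)"
    by (simp only: strict_mono_less_eq[OF strict_mono_block_start])
  then show ?thesis unfolding t(1) block_start_4 by (simp add: add.commute)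
qed

lemma N_le_occurrence:
  assumes "agreement i + 1 < m" and "factor w j m = factor w (N (i + 4) - 1) m"
  shows "N (i + 4) - 1 \<le> j"
proof -
  define q where "q = N (i + 4) - 1"
  have q: "Suc q = block_start (Suc i) 4"
    using N_pos[of "i + 4"] unfolding block_start_4 by (simp add: q_def add.commute)
  have same_letters: "w (j + u) = w (q + u)" if "u < m" for u
    using assms(2) that by (simp add: factor_eq_iff q_def)
  have "w q = block_last (Suc i) (w 3)"
    by (rule last_of_block) (simp only: q Suc_numeral add_num_simps)
  then have "w j = block_last (Suc i) L0"
    using same_letters[of 0] assms(1) first_letters by simp
  moreover have "prefix_occurs w (Suc q) (Suc (agreement i))"
    using prefix_occurs_block_start[of i 4] nth_agreement_eq_iff[of i 4] first_letters
    by (simp add: q prefix_occurs_Suc del: funpow.simps)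
  then have "prefix_occurs w (Suc j) (Suc (agreement i))"
    using same_letters[of "Suc u" for u] assms(1) by (simp add: prefix_occurs_iff)
  ultimately show ?thesis using N_le_recognized_boundary by fastforce
qed

end

theorem theorem9:
  fixes n :: "nat \<Rightarrow> letter" and m i :: nat
  assumes "is_fixed_point narayana_morphism n" and "n 0 = L0"
    and "m \<ge> 2" and "D i < int m" and "int m \<le> D (i + 1)"
  shows "int (appearance n m) = int (N (i + 4)) - 1"
proof -
  have "narayana_morphism a \<noteq> []" for a by (cases a) simp_all
  then interpret narayana_word n by unfold_locales (use assms in auto)
  have lower: "agreement i + 1 < m" and upper: "m \<le> agreement (Suc i) + 1"
    using assms D_eq_agreement[of i] D_eq_agreement[of "i + 1"] by auto
  have "appearance n m = N (i + 4) - 1"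
  proof (rule appearance_eqI)
    fix k
    obtain j where "j < N (i + 4)" "factor n j m = factor n k m"
      using factor_occurs_below_N[OF upper] by blast
    then show "\<exists>j \<le> N (i + 4) - 1. factor n j m = factor n k m" by (intro exI[of _ j]) simp
  qed (rule N_le_occurrence[OF lower])
  then show ?thesis using N_pos[of "i + 4"] by simp
qed

end
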